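(* Let $s\ge 0$, let $1<\theta\le p$, and let $\rho:\mathbb{R}^N\to\mathbb{R}$, $\mathbb{R}^N=\mathbb{R}^{N_1}\times\mathbb{R}^{N_2}$, be a radial continuous function for which there exist $\alpha\ge 0$ and $C>0$ such that $$\rho(\mathbf{x})\ge C\left(1+\|\mathbf{x}\|^{2(s+1)}\right)^{\frac{\alpha}{2(s+1)}}\quad\text{for all }\mathbf{x}\in\mathbb{R}^N .$$ Let $x_0$ be the largest real root of the polynomial $$H(x)=x^4-\frac{16p\theta(p-1)}{\theta-1}\left(\frac{1}{p+\theta+2}\right)^2\left[x^2+\frac{p+\theta-2}{(p+\theta+2)(\theta-1)}\,x+\frac{p-1}{(\theta-1)(p+\theta+2)^2}\right].$$ If $$N_s<2\left[1+(2+\alpha)x_0\right],$$ then the system $$\Delta_s u=\rho(\mathbf{x})v^{-p},\qquad \Delta_s v=\rho(\mathbf{x})u^{-\theta},\qquad u,v>0\quad\text{in }\mathbb{R}^N$$ has no bounded stable solution $(u,v)$.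
   Context: $N=N_1+N_2$ with $N_1,N_2\ge 1$; points are $\mathbf{x}=(x,y)\in\mathbb{R}^{N_1}\times\mathbb{R}^{N_2}$, and $|x|,|y|$ are Euclidean norms. The Grushin operator is $\Delta_s=\Delta_x+|x|^{2s}\Delta_y$, where $\Delta_x,\Delta_y$ are the Laplacians in $x$ and $y$. The Grushin norm is $\|\mathbf{x}\|=(|x|^{2(s+1)}+|y|^2)^{\frac{1}{2(s+1)}}$; "radial" means depending only on $\|\mathbf{x}\|$. The homogeneous dimension is $N_s=N_1+(1+s)N_2$. A solution is a pair of positive functions $(u,v)\in C^2(\mathbb{R}^N)\times C^2(\mathbb{R}^N)$ satisfying the system; it is bounded if $u$ and $v$ are both bounded. A solution $(u,v)$ is stable if there are positive smooth functions $\varphi,\chi$ on $\mathbb{R}^N$ such that $$-\Delta_s\varphi=p\,\rho(\mathbf{x})\,v^{-p-1}\chi,\qquad -\Delta_s\chi=\theta\,\rho(\mathbf{x})\,u^{-\theta-1}\varphi\quad\text{in }\mathbb{R}^N.$$ *)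

theory Defs
  imports "HOL-Analysis.Analysis"
begin

definition partial_deriv :: "'c::euclidean_space \<Rightarrow> ('c \<Rightarrow> real) \<Rightarrow> 'c \<Rightarrow> real" where
  "partial_deriv b f z = frechet_derivative f (at z) b"

text \<open>\<open>C_diff k f\<close>: the function \<open>f\<close> is of class \<open>C\<^sup>k\<close> on the whole space.\<close>

primrec C_diff :: "nat \<Rightarrow> ('c::euclidean_space \<Rightarrow> real) \<Rightarrow> bool" where
  "C_diff 0 f \<longleftrightarrow> continuous_on UNIV f"
| "C_diff (Suc k) f \<longleftrightarrow>
     (\<forall>z. f differentiable (at z)) \<and> (\<forall>b\<in>Basis. C_diff k (partial_deriv b f))"

definition smooth :: "('c::euclidean_space \<Rightarrow> real) \<Rightarrow> bool" where
  "smooth f \<longleftrightarrow> (\<forall>k. C_diff k f)"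

definition laplacian_x :: "('a::euclidean_space \<times> 'b::euclidean_space \<Rightarrow> real) \<Rightarrow> 'a \<times> 'b \<Rightarrow> real" where
  "laplacian_x f z = (\<Sum>i\<in>Basis. partial_deriv (i, 0) (partial_deriv (i, 0) f) z)"

definition laplacian_y :: "('a::euclidean_space \<times> 'b::euclidean_space \<Rightarrow> real) \<Rightarrow> 'a \<times> 'b \<Rightarrow> real" where
  "laplacian_y f z = (\<Sum>j\<in>Basis. partial_deriv (0, j) (partial_deriv (0, j) f) z)"

text \<open>The weight \<open>|x|\<^sup>2\<^sup>s\<close>. For \<open>s = 0\<close> it is identically \<open>1\<close>, so that the Grushin operator is then
  the Laplacian; the case distinction is needed because \<open>0 powr 0 = 0\<close>.\<close>

definition grushin_weight :: "real \<Rightarrow> 'a::euclidean_space \<Rightarrow> real" where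
  "grushin_weight s x = (if s = 0 then 1 else norm x powr (2 * s))"

definition grushin_op ::
  "real \<Rightarrow> ('a::euclidean_space \<times> 'b::euclidean_space \<Rightarrow> real) \<Rightarrow> 'a \<times> 'b \<Rightarrow> real" where
  "grushin_op s f z = laplacian_x f z + grushin_weight s (fst z) * laplacian_y f z"

definition grushin_norm :: "real \<Rightarrow> 'a::euclidean_space \<times> 'b::euclidean_space \<Rightarrow> real" where
  "grushin_norm s z =
     (norm (fst z) powr (2 * (s + 1)) + (norm (snd z))\<^sup>2) powr (1 / (2 * (s + 1)))"

definition grushin_radial :: "real \<Rightarrow> ('a::euclidean_space \<times> 'b::euclidean_space \<Rightarrow> real) \<Rightarrow> bool" where
  "grushin_radial s f \<longleftrightarrow> (\<exists>g. \<forall>z. f z = g (grushin_norm s z))"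

definition homogeneous_dim :: "real \<Rightarrow> 'a::euclidean_space itself \<Rightarrow> 'b::euclidean_space itself \<Rightarrow> real" where
  "homogeneous_dim s _ _ = real DIM('a) + (1 + s) * real DIM('b)"

definition grushin_solution ::
  "real \<Rightarrow> real \<Rightarrow> real \<Rightarrow> ('a::euclidean_space \<times> 'b::euclidean_space \<Rightarrow> real) \<Rightarrow>
   ('a \<times> 'b \<Rightarrow> real) \<Rightarrow> ('a \<times> 'b \<Rightarrow> real) \<Rightarrow> bool" where
  "grushin_solution s p \<theta> \<rho> u v \<longleftrightarrow>
     C_diff 2 u \<and> C_diff 2 v \<and>
     (\<forall>z. u z > 0 \<and> v z > 0) \<and>
     (\<forall>z. grushin_op s u z = \<rho> z * v z powr (- p)) \<and>
     (\<forall>z. grushin_op s v z = \<rho> z * u z powr (- \<theta>))"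

definition grushin_stable ::
  "real \<Rightarrow> real \<Rightarrow> real \<Rightarrow> ('a::euclidean_space \<times> 'b::euclidean_space \<Rightarrow> real) \<Rightarrow>
   ('a \<times> 'b \<Rightarrow> real) \<Rightarrow> ('a \<times> 'b \<Rightarrow> real) \<Rightarrow> bool" where
  "grushin_stable s p \<theta> \<rho> u v \<longleftrightarrow>
     (\<exists>\<phi> \<psi>. smooth \<phi> \<and> smooth \<psi> \<and>
        (\<forall>z. \<phi> z > 0 \<and> \<psi> z > 0) \<and>
        (\<forall>z. - grushin_op s \<phi> z = p * \<rho> z * v z powr (- p - 1) * \<psi> z) \<and>
        (\<forall>z. - grushin_op s \<psi> z = \<theta> * \<rho> z * u z powr (- \<theta> - 1) * \<phi> z))"

definition H_poly :: "real \<Rightarrow> real \<Rightarrow> real \<Rightarrow> real" where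
  "H_poly p \<theta> x =
     x ^ 4 - 16 * p * \<theta> * (p - 1) / (\<theta> - 1) * (1 / (p + \<theta> + 2))\<^sup>2 *
       (x\<^sup>2 + (p + \<theta> - 2) / ((p + \<theta> + 2) * (\<theta> - 1)) * x
            + (p - 1) / ((\<theta> - 1) * (p + \<theta> + 2)\<^sup>2))"

end

theory Submission
  imports Defs
begin

text \<open>If \<open>v \<le> M\<close> then \<open>\<Delta>\<^sub>s u = \<rho> v\<^sup>-\<^sup>p \<ge> C M\<^sup>-\<^sup>p > 0\<close>, since \<open>\<alpha> \<ge> 0\<close> gives \<open>\<rho> \<ge> C\<close>. A bounded function
  cannot satisfy \<open>\<Delta>\<^sub>s u \<ge> \<delta> > 0\<close> on the whole space: subtract a small multiple of the barrier
  \<open>|x|\<^sup>2\<^sup>m + |y|\<^sup>2\<close>, where \<open>m \<ge> s + 1\<close>, and apply the second derivative test at a maximum point.\<close>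

section \<open>The second derivative test along a line\<close>

lemma second_derivative_nonpos_at_max:
  fixes g g' :: "real \<Rightarrow> real"
  assumes "\<And>t. (g has_real_derivative g' t) (at t)"
    and "(g' has_real_derivative L) (at 0)"
    and "\<And>t. g t \<le> g 0"
  shows "L \<le> 0"
proof (rule ccontr)
  assume "\<not> L \<le> 0"
  then have "L > 0" by simp
  have "g' 0 = 0"
    using DERIV_local_max[OF assms(1)[of 0] zero_less_one] assms(3) by blast
  \<comment> \<open>Since \<open>g' 0 = 0\<close> and \<open>g'\<close> has positive slope at 0,
    \<open>g'\<close> is positive just to the right of 0. So \<open>g\<close> increases strictly
    there, against maximality at 0.\<close>
  with DERIV_pos_inc_right[OF assms(2) \<open>L > 0\<close>]
  obtain d where d: "d > 0" "\<And>h. 0 < h \<Longrightarrow> h < d \<Longrightarrow> g' h > 0"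
    by (metis add_0)
  have "g 0 < g (d / 2)"
  proof (rule DERIV_pos_imp_increasing_open[of 0 "d / 2" g])
    show "continuous_on {0..d / 2} g"
      using DERIV_isCont[OF assms(1)] by (simp add: continuous_at_imp_continuous_on)
    show "\<exists>y. (g has_real_derivative y) (at x) \<and> 0 < y" if "0 < x" "x < d / 2" for x
      using assms(1)[of x] d(2)[of x] that by force
  qed (use d(1) in simp)
  with assms(3)[of "d / 2"] show False by simp
qed

lemma has_derivative_along_line:
  fixes f :: "'c::euclidean_space \<Rightarrow> real"
  assumes "f differentiable (at (z + t *\<^sub>R b))"
  shows "((\<lambda>t. f (z + t *\<^sub>R b)) has_real_derivative partial_deriv b f (z + t *\<^sub>R b)) (at t)"
proof -
  let ?D = "frechet_derivative f (at (z + t *\<^sub>R b))"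
  have D: "(f has_derivative ?D) (at (z + t *\<^sub>R b))"
    using assms by (simp add: frechet_derivative_works)
  have "((\<lambda>t. z + t *\<^sub>R b) has_derivative (\<lambda>h. h *\<^sub>R b)) (at t)"
    by (auto intro!: derivative_eq_intros)
  from has_derivative_compose[OF this D]
  have "((\<lambda>t. f (z + t *\<^sub>R b)) has_derivative (\<lambda>h. ?D (h *\<^sub>R b))) (at t)" .
  moreover have "?D (h *\<^sub>R b) = partial_deriv b f (z + t *\<^sub>R b) * h" for h
    using linear_scale[OF has_derivative_linear[OF D]] by (simp add: partial_deriv_def)
  ultimately show ?thesis by (simp add: has_field_derivative_def)
qed

text \<open>The one-variable test is applied to \<open>f\<close> along the line minus
  \<open>q\<close>. The comparison function enters only through its restriction \<open>q\<close> to
  that line, so its partial derivatives on the whole space are never computed.\<close>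

lemma second_partial_le_at_max:
  fixes f :: "'c::euclidean_space \<Rightarrow> real"
  assumes "C_diff 2 f" and "b \<in> Basis"
    and "\<And>t. (q has_real_derivative q' t) (at t)"
    and "(q' has_real_derivative L) (at 0)"
    and "\<And>t. f (z + t *\<^sub>R b) - q t \<le> f z - q 0"
  shows "partial_deriv b (partial_deriv b f) z \<le> L"
proof -
  have diff: "f differentiable (at w)" "partial_deriv b f differentiable (at w)" for w
    using assms(1,2) by (auto simp: numeral_2_eq_2)
  have "partial_deriv b (partial_deriv b f) z - L \<le> 0"
  proof (rule second_derivative_nonpos_at_max)
    show "((\<lambda>t. f (z + t *\<^sub>R b) - q t) has_real_derivative
            partial_deriv b f (z + t *\<^sub>R b) - q' t) (at t)" for t
      by (intro derivative_intros has_derivative_along_line diff assms(3))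
    show "((\<lambda>t. partial_deriv b f (z + t *\<^sub>R b) - q' t) has_real_derivative
            partial_deriv b (partial_deriv b f) z - L) (at 0)"
      using has_derivative_along_line[OF diff(2), where z = z and t = 0 and b = b]
      by (intro derivative_intros assms(4)) auto
  qed (use assms(5) in auto)
  then show ?thesis by simp
qed

section \<open>The barrier and the existence of a maximum point\<close>

text \<open>Writing |x|^2 as an inner product with a natural exponent makes this a polynomial, so
  its restrictions to lines can be differentiated everywhere, also at x = 0.\<close>

definition barrier :: "nat \<Rightarrow> 'a::euclidean_space \<times> 'b::euclidean_space \<Rightarrow> real" where
  "barrier m z = (fst z \<bullet> fst z) ^ m + snd z \<bullet> snd z"

lemma continuous_on_barrier: "continuous_on S (barrier m)"
  unfolding barrier_def by (intro continuous_intros)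

lemma inner_le_one_plus_power:
  fixes x :: "'a::real_inner"
  assumes "(x \<bullet> x) ^ Suc m \<le> c"
  shows "x \<bullet> x \<le> 1 + c"
proof (cases "x \<bullet> x \<le> 1")
  case True
  then show ?thesis using assms zero_le_power[OF inner_ge_zero, of x "Suc m"] by linarith
next
  case False
  then have "(x \<bullet> x) ^ 1 \<le> (x \<bullet> x) ^ Suc m" by (intro power_increasing) auto
  then show ?thesis using assms by simp
qed

text \<open>The barrier is coercive: it bounds |y|^2 directly and |x|^2 up to an additive 1. The
  exponent \<open>Suc m\<close> excludes 0, for which the barrier would not control x at
  all.\<close>

lemma compact_barrier_sublevel:
  "compact {z :: 'a::euclidean_space \<times> 'b::euclidean_space. barrier (Suc m) z \<le> c}"
proof -
  have "norm z \<le> sqrt (1 + 2 * \<bar>c\<bar>)" if "barrier (Suc m) z \<le> c" for z :: "'a \<times> 'b"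
  proof -
    have "(fst z \<bullet> fst z) ^ Suc m \<le> c" "snd z \<bullet> snd z \<le> c"
      using that zero_le_power[OF inner_ge_zero, of "fst z" "Suc m"] inner_ge_zero[of "snd z"]
      unfolding barrier_def by linarith+
    then have "z \<bullet> z \<le> 1 + 2 * \<bar>c\<bar>"
      using inner_le_one_plus_power[of "fst z" m c] by (simp add: inner_prod_def)
    then show ?thesis by (simp add: norm_eq_sqrt_inner)
  qed
  then have "bounded {z :: 'a \<times> 'b. barrier (Suc m) z \<le> c}"
    by (auto simp: bounded_iff)
  moreover have "closed {z :: 'a \<times> 'b. barrier (Suc m) z \<le> c}"
    by (intro closed_Collect_le continuous_on_barrier continuous_on_const)
  ultimately show ?thesis by (simp add: compact_eq_bounded_closed)
qed

text \<open>Where \<open>\<epsilon> * barrier\<close> exceeds M the difference is negative, while at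
  the origin it equals \<open>u 0 > 0\<close>. So a maximum over the compact set where
  \<open>\<epsilon> * barrier\<close> is at most M is global. The second conclusion records how far
  out the maximum point can lie as \<epsilon> shrinks.\<close>

lemma attains_max_minus_barrier:
  fixes u :: "'a::euclidean_space \<times> 'b::euclidean_space \<Rightarrow> real"
  assumes "continuous_on UNIV u" and "\<And>z. 0 < u z" and "\<And>z. u z \<le> M" and "\<epsilon> > 0"
  obtains z where "\<And>w. u w - \<epsilon> * barrier (Suc m) w \<le> u z - \<epsilon> * barrier (Suc m) z"
    and "\<epsilon> * barrier (Suc m) z \<le> M"
proof -
  let ?K = "{z :: 'a \<times> 'b. barrier (Suc m) z \<le> M / \<epsilon>}"
  let ?g = "\<lambda>z. u z - \<epsilon> * barrier (Suc m) z"
  have K: "z \<in> ?K \<longleftrightarrow> \<epsilon> * barrier (Suc m) z \<le> M" for z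
    using \<open>\<epsilon> > 0\<close> by (simp add: field_simps)
  have b0: "barrier (Suc m) (0 :: 'a \<times> 'b) = 0" by (simp add: barrier_def)
  have 0: "0 \<in> ?K" using K[of 0] assms(2)[of 0] assms(3)[of 0] by (simp add: b0)
  have "continuous_on ?K ?g"
    by (intro continuous_intros continuous_on_barrier continuous_on_subset[OF assms(1)]) auto
  then obtain z where z: "z \<in> ?K" "\<And>w. w \<in> ?K \<Longrightarrow> ?g w \<le> ?g z"
    using continuous_attains_sup[OF compact_barrier_sublevel, of m "M / \<epsilon>" ?g] 0 by blast
  have "?g w \<le> ?g z" for w
  proof (cases "w \<in> ?K")
    case False
    then have "?g w \<le> 0" using K[of w] assms(3)[of w] by simp
    also have "0 \<le> ?g 0" using assms(2)[of 0] by (simp add: b0)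
    also have "\<dots> \<le> ?g z" using z(2)[OF 0] .
    finally show ?thesis .
  qed (use z in auto)
  then show thesis using z(1) K that by blast
qed

section \<open>Bounds for the Grushin operator at a maximum point\<close>

text \<open>With m = k + 2, r = |x|^2 and a = \<open>fst z \<bullet> i\<close>, the second
  derivative of |x|^(2m) in direction \<open>i\<close> is 4m(m-1) r^(m-2) a^2 + 2m r^(m-1).
  Cauchy-Schwarz gives a^2 \<le> r, hence the bound 2m(2m-1) r^(m-1) in each of the
  \<open>DIM('a)\<close> directions.\<close>

lemma laplacian_x_le_at_max:
  fixes u :: "'a::euclidean_space \<times> 'b::euclidean_space \<Rightarrow> real"
  assumes "C_diff 2 u" and "\<epsilon> > 0"
    and max: "\<And>w. u w - \<epsilon> * barrier (Suc (Suc k)) w \<le> u z - \<epsilon> * barrier (Suc (Suc k)) z"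
  shows "laplacian_x u z \<le>
    \<epsilon> * (real DIM('a) * ((2 * k + 4) * (2 * k + 3)) * (fst z \<bullet> fst z) ^ Suc k)"
proof -
  let ?r = "fst z \<bullet> fst z"
  have "partial_deriv (i, 0) (partial_deriv (i, 0) u) z
          \<le> \<epsilon> * (((2 * k + 4) * (2 * k + 3)) * ?r ^ Suc k)" if i: "i \<in> Basis" for i :: 'a
  proof -
    let ?a = "fst z \<bullet> i"
    let ?P = "\<lambda>t. ?r + 2 * t * ?a + t\<^sup>2"
    \<comment> \<open>\<open>?P t\<close> is the squared norm of the x-component moved by t along
      the unit vector \<open>i\<close>.\<close>
    have line: "barrier (Suc (Suc k)) (z + t *\<^sub>R (i, 0)) = ?P t ^ Suc (Suc k) + snd z \<bullet> snd z" for t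
      using i by (simp add: barrier_def inner_add inner_commute power2_eq_square algebra_simps)
    have "partial_deriv (i, 0) (partial_deriv (i, 0) u) z
        \<le> \<epsilon> * (real (k + 2) * (real (k + 1) * ?r ^ k * (2 * ?a) * (2 * ?a) + 2 * ?r ^ Suc k))"
    proof (rule second_partial_le_at_max[OF assms(1)])
      show "(i, 0) \<in> (Basis :: ('a \<times> 'b) set)" using i by (simp add: Basis_prod_def)
      show "((\<lambda>t. \<epsilon> * (?P t ^ Suc (Suc k) + snd z \<bullet> snd z)) has_real_derivative
              \<epsilon> * (real (k + 2) * (?P t ^ Suc k * (2 * ?a + 2 * t)))) (at t)" for t
        by (auto intro!: derivative_eq_intros simp: algebra_simps simp del: power_Suc)
      show "((\<lambda>t. \<epsilon> * (real (k + 2) * (?P t ^ Suc k * (2 * ?a + 2 * t)))) has_real_derivative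
              \<epsilon> * (real (k + 2) * (real (k + 1) * ?r ^ k * (2 * ?a) * (2 * ?a) + 2 * ?r ^ Suc k))) (at 0)"
        by (auto intro!: derivative_eq_intros simp: algebra_simps simp del: power_Suc)
      show "u (z + t *\<^sub>R (i, 0)) - \<epsilon> * (?P t ^ Suc (Suc k) + snd z \<bullet> snd z)
          \<le> u z - \<epsilon> * (?P 0 ^ Suc (Suc k) + snd z \<bullet> snd z)" for t
        using max[of "z + t *\<^sub>R (i, 0)"] line[of t] line[of 0]
          by (simp only: scaleR_zero_left add_0_right)
    qed
    also have "\<dots> = \<epsilon> * (real (k + 2) * (4 * real (k + 1) * (?r ^ k * ?a\<^sup>2) + 2 * ?r ^ Suc k))"
      by (simp add: power2_eq_square algebra_simps)
    also have "\<dots> \<le> \<epsilon> * (real (k + 2) * (4 * real (k + 1) * ?r ^ Suc k + 2 * ?r ^ Suc k))"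
    proof -
      have "?a\<^sup>2 \<le> ?r"
        using Cauchy_Schwarz_ineq[of "fst z" i] i by simp
      then have "?r ^ k * ?a\<^sup>2 \<le> ?r ^ k * ?r" by (intro mult_left_mono) auto
      then show ?thesis
        using \<open>\<epsilon> > 0\<close> by (intro mult_left_mono add_right_mono) (auto simp: mult.commute)
    qed
    also have "\<dots> = \<epsilon> * (((2 * k + 4) * (2 * k + 3)) * ?r ^ Suc k)"
      by (simp add: algebra_simps)
    finally show ?thesis .
  qed
  then have "laplacian_x u z \<le> (\<Sum>i\<in>(Basis :: 'a set). \<epsilon> * (((2 * k + 4) * (2 * k + 3)) * ?r ^ Suc k))"
    unfolding laplacian_x_def by (rule sum_mono)
  then show ?thesis by (simp add: mult_ac)
qed

lemma laplacian_y_le_at_max: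
  fixes u :: "'a::euclidean_space \<times> 'b::euclidean_space \<Rightarrow> real"
  assumes "C_diff 2 u"
    and max: "\<And>w. u w - \<epsilon> * barrier m w \<le> u z - \<epsilon> * barrier m z"
  shows "laplacian_y u z \<le> \<epsilon> * (2 * real DIM('b))"
proof -
  have "partial_deriv (0, j) (partial_deriv (0, j) u) z \<le> \<epsilon> * 2" if j: "j \<in> Basis" for j :: 'b
  proof -
    let ?P = "\<lambda>t. snd z \<bullet> snd z + 2 * t * (snd z \<bullet> j) + t\<^sup>2"
    have line: "barrier m (z + t *\<^sub>R (0, j)) = (fst z \<bullet> fst z) ^ m + ?P t" for t
      using j by (simp add: barrier_def inner_add inner_commute power2_eq_square algebra_simps)
    show ?thesis
    proof (rule second_partial_le_at_max[OF assms(1)])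
      show "(0, j) \<in> (Basis :: ('a \<times> 'b) set)" using j by (simp add: Basis_prod_def)
      show "((\<lambda>t. \<epsilon> * ((fst z \<bullet> fst z) ^ m + ?P t)) has_real_derivative
              \<epsilon> * (2 * (snd z \<bullet> j) + 2 * t)) (at t)" for t
        by (auto intro!: derivative_eq_intros simp: algebra_simps)
      show "((\<lambda>t. \<epsilon> * (2 * (snd z \<bullet> j) + 2 * t)) has_real_derivative \<epsilon> * 2) (at 0)"
        by (auto intro!: derivative_eq_intros)
      show "u (z + t *\<^sub>R (0, j)) - \<epsilon> * ((fst z \<bullet> fst z) ^ m + ?P t)
          \<le> u z - \<epsilon> * ((fst z \<bullet> fst z) ^ m + ?P 0)" for t
        using max[of "z + t *\<^sub>R (0, j)"] line[of t] line[of 0]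
          by (simp only: scaleR_zero_left add_0_right)
    qed
  qed
  then have "laplacian_y u z \<le> (\<Sum>j\<in>(Basis :: 'b set). \<epsilon> * 2)"
    unfolding laplacian_y_def by (rule sum_mono)
  then show ?thesis by (simp add: mult_ac)
qed

lemma grushin_weight_nonneg: "0 \<le> grushin_weight s x"
  by (simp add: grushin_weight_def)

text \<open>The real exponent 2s is replaced by the even integer 2n. Raising the exponent increases
  the power only for |x| > 1; the summand 1 covers |x| \<le> 1 and the case s = 0.\<close>

lemma grushin_weight_le:
  assumes "0 \<le> s" and "s \<le> real n"
  shows "grushin_weight s x \<le> 1 + (x \<bullet> x) ^ n"
proof (cases "s = 0 \<or> norm x \<le> 1")
  case True
  have "grushin_weight s x \<le> 1"
    using True assms(1) by (auto simp: grushin_weight_def intro: powr_le1)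
  then show ?thesis using zero_le_power[OF inner_ge_zero, of x n] by linarith
next
  case False
  then have "norm x powr (2 * s) \<le> norm x powr (real (2 * n))"
    using assms by (intro powr_mono) auto
  also have "\<dots> = norm x ^ (2 * n)"
    using False by (subst powr_realpow) auto
  also have "\<dots> = (x \<bullet> x) ^ n"
    by (simp add: power_mult dot_square_norm)
  finally show ?thesis using False by (simp add: grushin_weight_def)
qed

text \<open>Both parts of the operator are bounded by multiples of 1 + r^(k+1), with r = |x|^2. This
  is one power of r below the leading term of the barrier, and that gap drives the final
  contradiction.\<close>

lemma grushin_op_le_at_max:
  fixes u :: "'a::euclidean_space \<times> 'b::euclidean_space \<Rightarrow> real"
  assumes "0 \<le> s" and "s \<le> real (Suc k)" and "C_diff 2 u" and "\<epsilon> > 0"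
    and max: "\<And>w. u w - \<epsilon> * barrier (Suc (Suc k)) w \<le> u z - \<epsilon> * barrier (Suc (Suc k)) z"
  shows "grushin_op s u z \<le> \<epsilon> *
    ((real DIM('a) * ((2 * k + 4) * (2 * k + 3)) + 2 * real DIM('b)) * (1 + (fst z \<bullet> fst z) ^ Suc k))"
proof -
  let ?r = "(fst z \<bullet> fst z) ^ Suc k"
  let ?A = "real DIM('a) * ((2 * k + 4) * (2 * k + 3))"
  have "laplacian_x u z \<le> \<epsilon> * (?A * ?r)"
    using laplacian_x_le_at_max[OF assms(3,4) max] .
  also have "\<dots> \<le> \<epsilon> * (?A * (1 + ?r))"
    using \<open>\<epsilon> > 0\<close> by (intro mult_left_mono) auto
  finally have x: "laplacian_x u z \<le> \<epsilon> * (?A * (1 + ?r))" .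
  have "grushin_weight s (fst z) * laplacian_y u z \<le> grushin_weight s (fst z) * (\<epsilon> * (2 * real DIM('b)))"
    by (intro mult_left_mono laplacian_y_le_at_max[OF assms(3) max] grushin_weight_nonneg)
  also have "\<dots> \<le> (1 + ?r) * (\<epsilon> * (2 * real DIM('b)))"
    using \<open>\<epsilon> > 0\<close> by (intro mult_right_mono grushin_weight_le assms(1,2)) auto
  finally show ?thesis using x unfolding grushin_op_def by (simp add: algebra_simps)
qed

section \<open>Contradiction from a uniform positive lower bound\<close>

text \<open>For r \<le> 1/\<eta> the constant dominates; beyond that, \<eta> r > 1. The lower power
  is thus absorbed into the next one with an arbitrarily small coefficient.\<close>

lemma power_interpolation:
  fixes r \<eta> :: real
  assumes "0 \<le> r" and "\<eta> > 0"
  shows "r ^ n \<le> \<eta> * r ^ Suc n + (1 / \<eta>) ^ n"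
proof (cases "r \<le> 1 / \<eta>")
  case True
  then have "r ^ n \<le> (1 / \<eta>) ^ n" using assms by (intro power_mono) auto
  moreover have "0 \<le> \<eta> * r ^ Suc n" using assms by simp
  ultimately show ?thesis by linarith
next
  case False
  then have "1 \<le> \<eta> * r" using assms by (simp add: field_simps)
  then have "1 * r ^ n \<le> (\<eta> * r) * r ^ n" using assms by (intro mult_right_mono) auto
  moreover have "0 \<le> (1 / \<eta>) ^ n" using assms by simp
  ultimately show ?thesis by (simp add: mult.assoc)
qed

lemma no_bounded_strict_subsolution:
  fixes u :: "'a::euclidean_space \<times> 'b::euclidean_space \<Rightarrow> real"
  assumes "0 \<le> s" and "C_diff 2 u" and pos: "\<And>z. 0 < u z" and bdd: "\<And>z. u z \<le> M"
    and "\<delta> > 0" and ge: "\<And>z. \<delta> \<le> grushin_op s u z"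
  shows False
proof -
  obtain k where k: "s \<le> real k" using real_arch_simple by blast
  define K where "K = real DIM('a) * ((2 * k + 4) * (2 * k + 3)) + 2 * real DIM('b)"
  \<comment> \<open>The parameters are tuned so that the two error terms
    \<open>K * \<eta> * M\<close> and \<open>\<epsilon> * K * c\<close> are each \<delta>/4. Since
    \<eta>, and with it \<open>c\<close>, is fixed before \<epsilon>, the choice is not
    circular.\<close>
  define \<eta> where "\<eta> = \<delta> / (4 * K * M)"
  define c where "c = 1 + (1 / \<eta>) ^ Suc k"
  define \<epsilon> where "\<epsilon> = \<delta> / (4 * K * c)"
  have "K > 0" unfolding K_def by (intro add_pos_pos mult_pos_pos) auto
  have "M > 0" using pos[of 0] bdd[of 0] by linarith
  have "\<eta> > 0" using \<open>K > 0\<close> \<open>M > 0\<close> \<open>\<delta> > 0\<close> by (simp add: \<eta>_def)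
  then have "c > 0" unfolding c_def by (intro add_pos_pos) auto
  then have "\<epsilon> > 0" using \<open>K > 0\<close> \<open>\<delta> > 0\<close> by (simp add: \<epsilon>_def)
  have cont: "continuous_on UNIV u"
    using assms(2) by (auto simp: numeral_2_eq_2 intro!: continuous_at_imp_continuous_on
        differentiable_imp_continuous_within)
  obtain z where z: "\<And>w. u w - \<epsilon> * barrier (Suc (Suc k)) w \<le> u z - \<epsilon> * barrier (Suc (Suc k)) z"
      and le: "\<epsilon> * barrier (Suc (Suc k)) z \<le> M"
    by (rule attains_max_minus_barrier[OF cont pos bdd \<open>\<epsilon> > 0\<close>, where m = "Suc k"]) blast
  let ?r = "fst z \<bullet> fst z"
  \<comment> \<open>The point \<open>z\<close> depends on \<epsilon> and may run off to infinity as
    \<epsilon> tends to 0, but \<epsilon> times the top power of \<open>?r\<close> stays below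
    M.\<close>
  have "\<epsilon> * ?r ^ Suc (Suc k) \<le> \<epsilon> * barrier (Suc (Suc k)) z"
    using \<open>\<epsilon> > 0\<close> by (intro mult_left_mono) (auto simp: barrier_def)
  with le have r: "\<epsilon> * ?r ^ Suc (Suc k) \<le> M" by linarith
  have "\<delta> \<le> grushin_op s u z" by (rule ge)
  also have "\<dots> \<le> \<epsilon> * (K * (1 + ?r ^ Suc k))"
    unfolding K_def using k by (intro grushin_op_le_at_max assms(1,2) \<open>\<epsilon> > 0\<close> z) auto
  also have "\<dots> \<le> \<epsilon> * (K * (\<eta> * ?r ^ Suc (Suc k) + c))"
    using power_interpolation[of ?r \<eta> "Suc k"] \<open>\<epsilon> > 0\<close> \<open>K > 0\<close> \<open>\<eta> > 0\<close>
    by (intro mult_left_mono) (auto simp: c_def simp del: power_Suc)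
  also have "\<dots> = K * \<eta> * (\<epsilon> * ?r ^ Suc (Suc k)) + \<epsilon> * K * c"
    by (simp add: algebra_simps)
  also have "\<dots> \<le> K * \<eta> * M + \<epsilon> * K * c"
    using r \<open>K > 0\<close> \<open>\<eta> > 0\<close> by (intro add_right_mono mult_left_mono) auto
  also have "\<dots> = \<delta> / 2"
    using \<open>K > 0\<close> \<open>M > 0\<close> \<open>c > 0\<close> by (simp add: \<eta>_def \<epsilon>_def field_simps)
  finally show False using \<open>\<delta> > 0\<close> by simp
qed

section \<open>Application to the first equation of the system\<close>

theorem theorem1p1:
  fixes s p \<theta> \<alpha> C x0 :: real
    and \<rho> :: "'a::euclidean_space \<times> 'b::euclidean_space \<Rightarrow> real"
  assumes "s \<ge> 0"
    and "1 < \<theta>" and "\<theta> \<le> p"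
    and "continuous_on UNIV \<rho>" and "grushin_radial s \<rho>"
    and "\<alpha> \<ge> 0" and "C > 0"
    and "\<forall>z. \<rho> z \<ge> C * (1 + grushin_norm s z powr (2 * (s + 1))) powr (\<alpha> / (2 * (s + 1)))"
    and "H_poly p \<theta> x0 = 0" and "\<forall>x. H_poly p \<theta> x = 0 \<longrightarrow> x \<le> x0"
    and "homogeneous_dim s TYPE('a) TYPE('b) < 2 * (1 + (2 + \<alpha>) * x0)"
  shows "\<not> (\<exists>u v. grushin_solution s p \<theta> \<rho> u v \<and>
                 bounded (range u) \<and> bounded (range v) \<and>
                 grushin_stable s p \<theta> \<rho> u v)"
proof
  assume "\<exists>u v. grushin_solution s p \<theta> \<rho> u v \<and>
                 bounded (range u) \<and> bounded (range v) \<and>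
                 grushin_stable s p \<theta> \<rho> u v"
  then obtain u v where sol: "grushin_solution s p \<theta> \<rho> u v"
    and "bounded (range u)" "bounded (range v)" by blast
  then obtain M M' where M: "\<And>z. \<bar>u z\<bar> \<le> M" and M': "\<And>z. \<bar>v z\<bar> \<le> M'"
    by (auto simp: bounded_iff)
  have pos: "0 < u z" "0 < v z" for z using sol unfolding grushin_solution_def by blast+
  have "M' > 0" using pos(2)[of 0] M'[of 0] by linarith
  \<comment> \<open>This constant serves as \<delta>. The base in the lower bound for \<rho> is at
    least 1 and its exponent is nonnegative, so \<rho> is at least C; the negative power of
    \<open>v\<close> is smallest where \<open>v\<close> is largest, which the bound M'
    controls.\<close>
  have "C * M' powr (- p) \<le> grushin_op s u z" for z
  proof -
    have "C * 1 \<le> C * (1 + grushin_norm s z powr (2 * (s + 1))) powr (\<alpha> / (2 * (s + 1)))"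
      using assms(1,6,7) by (intro mult_left_mono ge_one_powr_ge_zero) auto
    also have "\<dots> \<le> \<rho> z" using assms(8) by blast
    finally have "C \<le> \<rho> z" by simp
    moreover have "M' powr (- p) \<le> v z powr (- p)"
      using pos(2)[of z] M'[of z] assms(2,3) by (intro powr_mono2') auto
    ultimately have "C * M' powr (- p) \<le> \<rho> z * v z powr (- p)"
      using assms(7) by (intro mult_mono) auto
    then show ?thesis using sol unfolding grushin_solution_def by metis
  qed
  moreover have "C * M' powr (- p) > 0" using assms(7) \<open>M' > 0\<close> by simp
  moreover have "u z \<le> M" for z using M[of z] by linarith
  moreover have "C_diff 2 u" using sol by (simp add: grushin_solution_def)
  ultimately show False
    using no_bounded_strict_subsolution[OF assms(1)] pos(1) by blast
qed

end
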